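(* Let $\phi:S_0\to S_1$ be a homomorphism of nonempty commutative semigroups, let $G$ be a group, and let $f:S_1\to G$ be a polynomial map of degree $d$. Then the induced function $f^*=f\circ\phi:S_0\to G$ is a polynomial map of degree $\le d$. In particular, if $S_0=S_1$ and $\phi:S_1\to S_1$ is an automorphism of commutative semigroups, then $f^*=f\circ\phi$ has the same degree as $f$.
   Context: Let $S$ be a nonempty commutative semigroup (written additively) and $G$ a group with identity $1_G$. A map $f:S\to G$ is a polynomial map of degree $-\infty$ if $f(s)=1_G$ for all $s$, and of degree $0$ if it is constant with value different from $1_G$. Thus degree $\le 0$ means constant. Inductively, for $d\in\{0,1,2,\dots\}$, $f$ is a polynomial map of degree $\le d+1$ if for every $s\in S$ both maps $L_s(f):t\mapsto f(s+t)f(t)^{-1}$ and $R_s(f):t\mapsto f(t)^{-1}f(s+t)$ from $S$ to $G$ are polynomial maps of degree $\le d$. The degree of a polynomial map is the least such $d\in\{-\infty,0,1,2,\dots\}$. A map is a polynomial map if it is a polynomial map of degree $\le d$ for some $d$. *)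

theory Defs
  imports "HOL-Algebra.Group" "HOL-Library.Option_ord"
begin

text \<open>
  A commutative semigroup is carried by a \<open>monoid\<close> record, so that the library notions
  \<^const>\<open>hom\<close> and \<^const>\<open>iso\<close> apply. The field \<^const>\<open>one\<close> of the record plays no role: no
  axiom mentions it, and neither \<^const>\<open>hom\<close> nor \<^const>\<open>iso\<close> refers to it. The semigroup
  operation is written \<open>\<otimes>\<close>.
\<close>

locale comm_semigroup =
  fixes S (structure)
  assumes nonempty: "carrier S \<noteq> {}"
    and m_closed: "\<lbrakk>x \<in> carrier S; y \<in> carrier S\<rbrakk> \<Longrightarrow> x \<otimes> y \<in> carrier S"
    and m_assoc: "\<lbrakk>x \<in> carrier S; y \<in> carrier S; z \<in> carrier S\<rbrakk>
      \<Longrightarrow> (x \<otimes> y) \<otimes> z = x \<otimes> (y \<otimes> z)"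
    and m_comm: "\<lbrakk>x \<in> carrier S; y \<in> carrier S\<rbrakk> \<Longrightarrow> x \<otimes> y = y \<otimes> x"

definition left_diff ::
  "('a, 'm) monoid_scheme \<Rightarrow> ('g, 'n) monoid_scheme \<Rightarrow> 'a \<Rightarrow> ('a \<Rightarrow> 'g) \<Rightarrow> 'a \<Rightarrow> 'g" where
  "left_diff S G s f = (\<lambda>t. f (s \<otimes>\<^bsub>S\<^esub> t) \<otimes>\<^bsub>G\<^esub> inv\<^bsub>G\<^esub> (f t))"

definition right_diff ::
  "('a, 'm) monoid_scheme \<Rightarrow> ('g, 'n) monoid_scheme \<Rightarrow> 'a \<Rightarrow> ('a \<Rightarrow> 'g) \<Rightarrow> 'a \<Rightarrow> 'g" where
  "right_diff S G s f = (\<lambda>t. inv\<^bsub>G\<^esub> (f t) \<otimes>\<^bsub>G\<^esub> f (s \<otimes>\<^bsub>S\<^esub> t))"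

text \<open>
  Degrees are of type \<^typ>\<open>nat option\<close>: \<^const>\<open>None\<close> stands for \<open>-\<infinity>\<close>, which is the least element
  of the order of \<^theory>\<open>HOL-Library.Option_ord\<close>. The predicate \<open>poly_map_le S G d f\<close> says that
  \<open>f\<close> is a polynomial map of degree at most \<open>d\<close>; it depends only on the values of \<open>f\<close> on
  \<open>carrier S\<close>.
\<close>

primrec poly_map_le_nat ::
  "('a, 'm) monoid_scheme \<Rightarrow> ('g, 'n) monoid_scheme \<Rightarrow> nat \<Rightarrow> ('a \<Rightarrow> 'g) \<Rightarrow> bool" where
  "poly_map_le_nat S G 0 f \<longleftrightarrow> (\<exists>c \<in> carrier G. \<forall>s \<in> carrier S. f s = c)"
| "poly_map_le_nat S G (Suc d) f \<longleftrightarrow>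
    f \<in> carrier S \<rightarrow> carrier G \<and>
    (\<forall>s \<in> carrier S. poly_map_le_nat S G d (left_diff S G s f) \<and>
                    poly_map_le_nat S G d (right_diff S G s f))"

primrec poly_map_le ::
  "('a, 'm) monoid_scheme \<Rightarrow> ('g, 'n) monoid_scheme \<Rightarrow> nat option \<Rightarrow> ('a \<Rightarrow> 'g) \<Rightarrow> bool" where
  "poly_map_le S G None f \<longleftrightarrow> (\<forall>s \<in> carrier S. f s = \<one>\<^bsub>G\<^esub>)"
| "poly_map_le S G (Some d) f \<longleftrightarrow> poly_map_le_nat S G d f"

definition poly_map ::
  "('a, 'm) monoid_scheme \<Rightarrow> ('g, 'n) monoid_scheme \<Rightarrow> ('a \<Rightarrow> 'g) \<Rightarrow> bool" where
  "poly_map S G f \<longleftrightarrow> (\<exists>d. poly_map_le S G d f)"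

text \<open>Only meaningful for polynomial maps; otherwise the value is unspecified.\<close>

definition poly_map_degree ::
  "('a, 'm) monoid_scheme \<Rightarrow> ('g, 'n) monoid_scheme \<Rightarrow> ('a \<Rightarrow> 'g) \<Rightarrow> nat option" where
  "poly_map_degree S G f = (LEAST d. poly_map_le S G d f)"

text \<open>Degrees \<open>-\<infinity>\<close> and \<open>0\<close> are as expected, and the bounds are monotone in \<open>d\<close>.\<close>

lemma poly_map_degree_le:
  assumes "poly_map_le S G d f"
  shows "poly_map_degree S G f \<le> d"
  unfolding poly_map_degree_def by (rule Least_le) (rule assms)

lemma poly_map_le_degree:
  assumes "poly_map S G f"
  shows "poly_map_le S G (poly_map_degree S G f) f"
  using assms unfolding poly_map_def poly_map_degree_def by (rule LeastI_ex)

lemma poly_map_degree_None_iff: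
  assumes "poly_map S G f"
  shows "poly_map_degree S G f = None \<longleftrightarrow> (\<forall>s \<in> carrier S. f s = \<one>\<^bsub>G\<^esub>)"
  using poly_map_le_degree [OF assms] poly_map_degree_le [of S G None f]
  by (auto dest: less_eq_option_None_is_None)

lemma poly_map_degree_0_iff:
  assumes "comm_semigroup S" "group G" "poly_map S G f"
  shows "poly_map_degree S G f = Some 0 \<longleftrightarrow>
    (\<exists>c \<in> carrier G. c \<noteq> \<one>\<^bsub>G\<^esub> \<and> (\<forall>s \<in> carrier S. f s = c))"
proof
  assume deg: "poly_map_degree S G f = Some 0"
  then have "\<not> (\<forall>s \<in> carrier S. f s = \<one>\<^bsub>G\<^esub>)"
    using poly_map_degree_None_iff [OF assms(3)] by simp
  then show "\<exists>c \<in> carrier G. c \<noteq> \<one>\<^bsub>G\<^esub> \<and> (\<forall>s \<in> carrier S. f s = c)"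
    using poly_map_le_degree [OF assms(3)] deg by auto
next
  assume c: "\<exists>c \<in> carrier G. c \<noteq> \<one>\<^bsub>G\<^esub> \<and> (\<forall>s \<in> carrier S. f s = c)"
  then have "poly_map_degree S G f \<le> Some 0"
    by (intro poly_map_degree_le) auto
  moreover have "poly_map_degree S G f \<noteq> None"
    using c comm_semigroup.nonempty [OF assms(1)] poly_map_degree_None_iff [OF assms(3)] by auto
  ultimately show "poly_map_degree S G f = Some 0"
    by (cases "poly_map_degree S G f") auto
qed

lemma poly_map_le_nat_Suc:
  assumes "comm_semigroup S" "group G" "poly_map_le_nat S G d f"
  shows "poly_map_le_nat S G (Suc d) f"
  using assms(3)
proof (induction d arbitrary: f)
  case 0
  then obtain c where c: "c \<in> carrier G" "\<And>s. s \<in> carrier S \<Longrightarrow> f s = c"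
    by auto
  interpret G: group G by (rule assms(2))
  show ?case
    using c comm_semigroup.m_closed [OF assms(1)]
    by (auto simp: left_diff_def right_diff_def)
next
  case (Suc d)
  then show ?case
    by (metis poly_map_le_nat.simps(2))
qed

lemma poly_map_le_mono:
  assumes "comm_semigroup S" "group G" "poly_map_le S G d f" "d \<le> e"
  shows "poly_map_le S G e f"
proof (cases d)
  case None
  have "poly_map_le_nat S G n f" if "poly_map_le_nat S G 0 f" for n
    using that by (induction n) (blast intro: poly_map_le_nat_Suc [OF assms(1,2)])+
  moreover have "poly_map_le_nat S G 0 f"
    using None assms(2,3) by (auto intro: group.is_monoid monoid.one_closed)
  ultimately show ?thesis
    using None assms(3) by (cases e) auto
next
  case (Some m)
  then obtain n where n: "e = Some n" "m \<le> n"
    using assms(4) by (cases e) auto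
  from n(2) have "poly_map_le_nat S G n f"
    by (induction rule: dec_induct)
      (use Some assms(3) in \<open>auto simp del: poly_map_le_nat.simps
        intro: poly_map_le_nat_Suc [OF assms(1,2)]\<close>)
  then show ?thesis using n by simp
qed

end

theory Submission imports Defs begin

text \<open>
  Pulling back along a homomorphism commutes with taking differences: if \<open>\<phi>\<close> is a homomorphism,
  then \<open>L\<^sub>s (f \<circ> \<phi>) = L\<^bsub>\<phi> s\<^esub> f \<circ> \<phi>\<close> on the carrier, since \<open>\<phi>\<close> turns translation by \<open>s\<close> into
  translation by \<open>\<phi> s\<close>, and likewise for \<open>R\<^sub>s\<close>. Induction on the degree bound therefore carries
  every bound for \<open>f\<close> over to \<open>f \<circ> \<phi>\<close> (\<open>poly_map_le_pullback\<close>). If \<open>\<phi>\<close> is an isomorphism, its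
  inverse carries bounds back, so that \<open>f\<close> and \<open>f \<circ> \<phi>\<close> have the same degree bounds
  (\<open>poly_map_le_iso_iff\<close>) and hence the same degree.
\<close>

text \<open>
  The pullback is a function \<open>g\<close> that agrees with \<open>f \<circ> \<phi>\<close> on the carrier, rather than \<open>f \<circ> \<phi>\<close>
  itself: the identity between differences that drives the induction holds on the carrier only.
  In the same way, composing with an isomorphism and then with its inverse gives back \<open>f\<close> on the
  carrier only.
\<close>

lemma poly_map_le_nat_pullback:
  assumes "comm_semigroup S" "\<phi> \<in> hom S T" "poly_map_le_nat T G n f"
    and "\<And>s. s \<in> carrier S \<Longrightarrow> g s = f (\<phi> s)"
  shows "poly_map_le_nat S G n g"
  using assms(3,4)
proof (induction n arbitrary: f g)
  case 0
  then show ?case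
    using hom_in_carrier [OF assms(2)] by fastforce
next
  case (Suc n)
  have \<phi>: "\<phi> s \<in> carrier T" if "s \<in> carrier S" for s
    using hom_in_carrier [OF assms(2) that] .
  have translate: "g (s \<otimes>\<^bsub>S\<^esub> t) = f (\<phi> s \<otimes>\<^bsub>T\<^esub> \<phi> t)" if "s \<in> carrier S" "t \<in> carrier S" for s t
    using that Suc.prems(2) comm_semigroup.m_closed [OF assms(1)] hom_mult [OF assms(2)]
    by simp
  have "g \<in> carrier S \<rightarrow> carrier G"
    using Suc.prems \<phi> by auto
  moreover have "poly_map_le_nat S G n (left_diff S G s g)" if s: "s \<in> carrier S" for s
  proof (rule Suc.IH)
    show "poly_map_le_nat T G n (left_diff T G (\<phi> s) f)"
      using Suc.prems(1) \<phi> [OF s] by simp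
    show "left_diff S G s g t = left_diff T G (\<phi> s) f (\<phi> t)" if "t \<in> carrier S" for t
      using translate [OF s that] Suc.prems(2) [OF that] by (simp add: left_diff_def)
  qed
  moreover have "poly_map_le_nat S G n (right_diff S G s g)" if s: "s \<in> carrier S" for s
  proof (rule Suc.IH)
    show "poly_map_le_nat T G n (right_diff T G (\<phi> s) f)"
      using Suc.prems(1) \<phi> [OF s] by simp
    show "right_diff S G s g t = right_diff T G (\<phi> s) f (\<phi> t)" if "t \<in> carrier S" for t
      using translate [OF s that] Suc.prems(2) [OF that] by (simp add: right_diff_def)
  qed
  ultimately show ?case
    by simp
qed

lemma poly_map_le_pullback:
  assumes "comm_semigroup S" "\<phi> \<in> hom S T" "poly_map_le T G d f"
    and "\<And>s. s \<in> carrier S \<Longrightarrow> g s = f (\<phi> s)"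
  shows "poly_map_le S G d g"
proof (cases d)
  case None
  then show ?thesis
    using assms(3,4) hom_in_carrier [OF assms(2)] by auto
next
  case (Some n)
  then show ?thesis
    using assms(3) poly_map_le_nat_pullback [OF assms(1,2), of G n f g] assms(4) by simp
qed

lemma inv_into_hom:
  assumes "comm_semigroup S" "\<phi> \<in> iso S T"
  shows "inv_into (carrier S) \<phi> \<in> hom T S"
proof (rule homI)
  let ?\<psi> = "inv_into (carrier S) \<phi>"
  have bij: "bij_betw \<phi> (carrier S) (carrier T)" and hom: "\<phi> \<in> hom S T"
    using assms(2) by (auto simp: iso_def)
  show \<psi>: "?\<psi> x \<in> carrier S" if "x \<in> carrier T" for x
    using bij_betwE [OF bij_betw_inv_into [OF bij]] that by blast
  show "?\<psi> (x \<otimes>\<^bsub>T\<^esub> y) = ?\<psi> x \<otimes>\<^bsub>S\<^esub> ?\<psi> y" if "x \<in> carrier T" "y \<in> carrier T" for x y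
  proof (rule inv_into_f_eq)
    show "inj_on \<phi> (carrier S)"
      using bij by (rule bij_betw_imp_inj_on)
    show "?\<psi> x \<otimes>\<^bsub>S\<^esub> ?\<psi> y \<in> carrier S"
      using that \<psi> comm_semigroup.m_closed [OF assms(1)] by blast
    show "\<phi> (?\<psi> x \<otimes>\<^bsub>S\<^esub> ?\<psi> y) = x \<otimes>\<^bsub>T\<^esub> y"
      using that by (simp add: hom_mult [OF hom] \<psi> bij_betw_inv_into_right [OF bij])
  qed
qed

lemma poly_map_le_iso_iff:
  assumes "comm_semigroup S" "comm_semigroup T" "\<phi> \<in> iso S T"
  shows "poly_map_le S G d (f \<circ> \<phi>) \<longleftrightarrow> poly_map_le T G d f"
proof
  assume "poly_map_le T G d f"
  with assms(1,3) show "poly_map_le S G d (f \<circ> \<phi>)"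
    by (auto simp: iso_def intro: poly_map_le_pullback)
next
  have bij: "bij_betw \<phi> (carrier S) (carrier T)"
    using assms(3) by (simp add: iso_def)
  assume "poly_map_le S G d (f \<circ> \<phi>)"
  with assms(2) inv_into_hom [OF assms(1,3)] show "poly_map_le T G d f"
    by (rule poly_map_le_pullback) (simp add: bij_betw_inv_into_right [OF bij])
qed

theorem proposition3:
  fixes S\<^sub>0 :: "('a, 'm) monoid_scheme"
    and S\<^sub>1 :: "('b, 'n) monoid_scheme"
    and G :: "('g, 'k) monoid_scheme"
    and f :: "'b \<Rightarrow> 'g"
    and d :: "nat option"
  assumes "comm_semigroup S\<^sub>0" and "comm_semigroup S\<^sub>1" and "group G"
    and "poly_map S\<^sub>1 G f" and "poly_map_degree S\<^sub>1 G f = d"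
  shows "(\<forall>\<phi> \<in> hom S\<^sub>0 S\<^sub>1. poly_map_le S\<^sub>0 G d (f \<circ> \<phi>)) \<and>
    (\<forall>\<phi> \<in> iso S\<^sub>1 S\<^sub>1. poly_map S\<^sub>1 G (f \<circ> \<phi>) \<and>
      poly_map_degree S\<^sub>1 G (f \<circ> \<phi>) = poly_map_degree S\<^sub>1 G f)"
proof (intro conjI ballI)
  have le: "poly_map_le S\<^sub>1 G d f"
    using poly_map_le_degree [OF assms(4)] assms(5) by simp
  show "poly_map_le S\<^sub>0 G d (f \<circ> \<phi>)" if "\<phi> \<in> hom S\<^sub>0 S\<^sub>1" for \<phi>
    using poly_map_le_pullback [OF assms(1) that le] by simp
  fix \<phi> assume "\<phi> \<in> iso S\<^sub>1 S\<^sub>1"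
  note iff = poly_map_le_iso_iff [OF assms(2,2) this]
  show "poly_map S\<^sub>1 G (f \<circ> \<phi>)"
    using assms(4) by (simp add: poly_map_def iff)
  show "poly_map_degree S\<^sub>1 G (f \<circ> \<phi>) = poly_map_degree S\<^sub>1 G f"
    by (simp add: poly_map_degree_def iff)
qed

end
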